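(* Let $A,B\subseteq \mathbb{R}^2$ be two closed convex cones with more than one common point. Then there exists an $n\in \mathbb{N}$ such that for any starting point $x_0\in \mathbb{R}^2$, the Douglas--Rachford method applied to $(A, B)$ converges in at most $n$ iterations, that is, $T_{DR}^n(x_0)\in\operatorname{Fix} T_{DR}$.
   Context: A set $S$ is a cone if $\lambda x\in S$ for all $x\in S$ and all $\lambda\in(0,+\infty)$. For a nonempty closed convex set $C\subseteq\mathbb{R}^2$, $P_C(x)$ is the unique nearest point of $C$ to $x$ in the Euclidean norm, and $R_C = 2P_C-\mathrm{Id}$. The Douglas--Rachford operator of the ordered pair $(A,B)$ is $T_{DR} = \frac12(\mathrm{Id}+R_B\circ R_A)$. $\operatorname{Fix} T=\{x : T(x)=x\}$, and $T^n$ is the $n$-fold composition. The Douglas--Rachford method from $x_0$ generates $x_n=T_{DR}^n(x_0)$. *)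

theory Defs
  imports "HOL-Analysis.Analysis"
begin

text \<open>Only strictly positive scalars are required, whereas the library's \<open>cone\<close> also admits
  the scalar 0; the two notions agree for closed sets.\<close>

definition pos_cone :: "'a::real_vector set \<Rightarrow> bool"
  where "pos_cone S \<longleftrightarrow> (\<forall>x\<in>S. \<forall>c>0. c *\<^sub>R x \<in> S)"

text \<open>The projection onto a nonempty closed convex set is the library's \<open>closest_point\<close>.\<close>

definition reflector :: "'a::euclidean_space set \<Rightarrow> 'a \<Rightarrow> 'a"
  where "reflector C x = 2 *\<^sub>R closest_point C x - x"

definition T_DR :: "'a::euclidean_space set \<Rightarrow> 'a set \<Rightarrow> 'a \<Rightarrow> 'a"
  where "T_DR A B x = (1/2) *\<^sub>R (x + (reflector B \<circ> reflector A) x)"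

definition Fix :: "('a \<Rightarrow> 'a) \<Rightarrow> 'a set"
  where "Fix T = {x. T x = x}"

end

theory Submission
  imports Defs
begin

text \<open>Fix a unit vector \<open>e\<close> in \<open>A \<inter> B\<close>. With \<open>p\<close> the projection of \<open>x\<close> onto \<open>A\<close>, \<open>y = 2p - x\<close> the
reflected point and \<open>b\<close> the projection of \<open>y\<close> onto \<open>B\<close>, the operator is
\<open>T x = x - p + b = p - (y - b)\<close>, and since residuals of projections lie in the polar cones, the
coordinate along \<open>e\<close> does not decrease: \<open>x \<bullet> e \<le> p \<bullet> e \<le> T x \<bullet> e\<close>.

Each projection is locally the identity, zero, or the orthogonal projection onto an edge
ray of the cone. The only combination that can occur many times before a fixed point is reached is edge with edge, and
there \<open>T\<close> is a rotation times the cosine of its angle, the angle being the one from the line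
of \<open>p\<close> to the line of \<open>b\<close>. A nontrivial rotation cannot keep a nonzero point in a closed quadrant for
more than a number of steps that depends only on the angle, and a trivial one fixes the point
(\<open>uniformly_finite_two_lines\<close>). So the proof bounds the time spent outside such phases and shows
that each phase stays in one quadrant with one pair of edges.

For \<open>x\<close> outside \<open>A\<close> and \<open>y\<close> outside \<open>B\<close>, the orientation of the two turns decides. Suppose that
\<open>x\<close> is counterclockwise of \<open>p\<close>; the other case is the mirror image, obtained by negating the second
vector \<open>f\<close> of the frame. If \<open>y\<close> is counterclockwise of \<open>b\<close> and the angle between \<open>b\<close> and \<open>p\<close> is
not obtuse, then \<open>T x\<close> lands in the sector between \<open>b\<close> and \<open>p\<close>, which lies in \<open>A\<close>, and the next
projection onto \<open>B\<close> stays in that sector, so two steps suffice (\<open>cw_two_steps\<close>). If \<open>y\<close> is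
clockwise of \<open>b\<close>, a rotation phase takes place (\<open>rotating\<close>). If \<open>y\<close> lies in \<open>B\<close>, then \<open>T x = p\<close>
and again two steps suffice.

In the half-plane \<open>x \<bullet> e > 0\<close> these are the only alternatives (\<open>quadrant_cases\<close>). If \<open>x \<bullet> e < 0\<close>, then
\<open>p \<bullet> e \<ge> 0\<close> sends \<open>T x\<close> to the forward half-plane, and \<open>p \<bullet> e < 0\<close> leaves the same
alternatives, together with \<open>b = 0\<close> and with an obtuse angle between \<open>b\<close> and \<open>p\<close>; these reach the
forward half-plane within two further steps (\<open>uniformly_finite_backward\<close>).

The argument puts a whole sector below the edge \<open>p\<close> into \<open>A\<close>, which fails if \<open>A\<close> is a line. Then
the reflection in \<open>A\<close> is a linear involution that conjugates the operator of \<open>(A, B)\<close> to that of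
\<open>(B, A)\<close>; and if both cones are the same line, \<open>T\<close> is the identity.\<close>

section \<open>Uniform finite convergence\<close>

definition uniformly_finite :: "('a \<Rightarrow> 'a) \<Rightarrow> 'a set \<Rightarrow> bool"
  where "uniformly_finite T S \<longleftrightarrow> (\<exists>n. \<forall>x\<in>S. (T ^^ n) x \<in> Fix T)"

lemma funpow_Fix: "x \<in> Fix T \<Longrightarrow> (T ^^ n) x = x"
  by (induction n) (auto simp: Fix_def)

lemma funpow_Fix_mono:
  assumes "(T ^^ m) x \<in> Fix T" "m \<le> n"
  shows "(T ^^ n) x \<in> Fix T"
proof -
  have "(T ^^ n) x = (T ^^ (n - m)) ((T ^^ m) x)"
    using assms(2) by (metis comp_apply funpow_add le_add_diff_inverse2)
  then show ?thesis
    using assms(1) by (simp add: funpow_Fix)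
qed

lemma uniformly_finite_Fix: "S \<subseteq> Fix T \<Longrightarrow> uniformly_finite T S"
  unfolding uniformly_finite_def by (intro exI[of _ 0]) auto

lemma uniformly_finite_subset: "uniformly_finite T S \<Longrightarrow> W \<subseteq> S \<Longrightarrow> uniformly_finite T W"
  unfolding uniformly_finite_def by blast

lemma uniformly_finite_Un:
  assumes "uniformly_finite T S" "uniformly_finite T W"
  shows "uniformly_finite T (S \<union> W)"
proof -
  obtain m n where "\<forall>x\<in>S. (T ^^ m) x \<in> Fix T" "\<forall>x\<in>W. (T ^^ n) x \<in> Fix T"
    using assms unfolding uniformly_finite_def by blast
  then have "\<forall>x\<in>S \<union> W. (T ^^ max m n) x \<in> Fix T"
    by (meson UnE funpow_Fix_mono max.cobounded1 max.cobounded2)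
  then show ?thesis
    unfolding uniformly_finite_def by blast
qed

lemma uniformly_finite_step:
  assumes "uniformly_finite T S" "\<And>x. x \<in> W \<Longrightarrow> T x \<in> S"
  shows "uniformly_finite T W"
proof -
  obtain n where "\<forall>x\<in>S. (T ^^ n) x \<in> Fix T"
    using assms(1) unfolding uniformly_finite_def by blast
  then have "\<forall>x\<in>W. (T ^^ Suc n) x \<in> Fix T"
    using assms(2) by (simp add: funpow_swap1)
  then show ?thesis
    unfolding uniformly_finite_def by blast
qed

lemma uniformly_finite_two_steps:
  assumes "\<And>x. x \<in> W \<Longrightarrow> T (T x) \<in> Fix T"
  shows "uniformly_finite T W"
  unfolding uniformly_finite_def using assms by (intro exI[of _ 2]) (auto simp: numeral_2_eq_2)

section \<open>Orthonormal frames of the plane\<close>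

definition frame :: "real^2 \<Rightarrow> real^2 \<Rightarrow> bool"
  where "frame e f \<longleftrightarrow> e \<bullet> e = 1 \<and> f \<bullet> f = 1 \<and> e \<bullet> f = 0"

definition quarter_turn :: "real^2 \<Rightarrow> real^2 \<Rightarrow> real^2 \<Rightarrow> real^2"
  where "quarter_turn e f x = (x \<bullet> e) *\<^sub>R f - (x \<bullet> f) *\<^sub>R e"

lemma inner_real2: "(x::real^2) \<bullet> y = x $ 1 * y $ 1 + x $ 2 * y $ 2"
  by (simp add: inner_vec_def sum_2)

lemma frame_swap: "frame e f \<Longrightarrow> frame f e"
  by (simp add: frame_def inner_commute)

lemma frame_minus: "frame e f \<Longrightarrow> frame e (- f)"
  by (simp add: frame_def)

lemma frame_exists:
  assumes "e \<bullet> e = 1"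
  shows "\<exists>f. frame e f"
proof (intro exI)
  show "frame e (vector [- e $ 2, e $ 1])"
    using assms by (simp add: frame_def inner_real2 algebra_simps)
qed

lemma inner_frame:
  assumes "frame e f"
  shows "x \<bullet> y = (x \<bullet> e) * (y \<bullet> e) + (x \<bullet> f) * (y \<bullet> f)"
proof -
  have "e $ 1 * e $ 1 + e $ 2 * e $ 2 = 1" "f $ 1 * f $ 1 + f $ 2 * f $ 2 = 1"
    "e $ 1 * f $ 1 + e $ 2 * f $ 2 = 0"
    using assms by (simp_all add: frame_def inner_real2)
  then show ?thesis
    unfolding inner_real2 by algebra
qed

lemma frame_eqI:
  assumes "frame e f" "x \<bullet> e = y \<bullet> e" "x \<bullet> f = y \<bullet> f"
  shows "x = y"
proof -
  have "(x - y) \<bullet> (x - y) = 0"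
    using assms by (subst inner_frame[OF assms(1)]) (simp add: inner_diff_left)
  then show ?thesis
    by simp
qed

lemma frame_inner_simps:
  assumes "frame e f"
  shows "e \<bullet> e = 1" "f \<bullet> f = 1" "e \<bullet> f = 0" "f \<bullet> e = 0"
    "quarter_turn e f x \<bullet> e = - (x \<bullet> f)" "quarter_turn e f x \<bullet> f = x \<bullet> e"
  using assms by (auto simp: frame_def quarter_turn_def inner_diff_left inner_commute[of f e])

lemma inner_quarter_turn:
  assumes "frame e f"
  shows "x \<bullet> quarter_turn e f y = (x \<bullet> f) * (y \<bullet> e) - (x \<bullet> e) * (y \<bullet> f)"
  using inner_frame[OF assms, of x "quarter_turn e f y"]
  by (simp add: frame_inner_simps[OF assms])

lemma orthogonal_quarter_turn:
  assumes "frame e f" "p \<noteq> 0" "u \<bullet> p = 0"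
  obtains t where "u = t *\<^sub>R quarter_turn e f p"
proof -
  note fr = frame_inner_simps[OF assms(1)]
  have o: "(u \<bullet> e) * (p \<bullet> e) + (u \<bullet> f) * (p \<bullet> f) = 0"
    using assms(3) inner_frame[OF assms(1)] by metis
  have n: "p \<bullet> p = (p \<bullet> e) * (p \<bullet> e) + (p \<bullet> f) * (p \<bullet> f)"
    by (rule inner_frame[OF assms(1)])
  have "p \<bullet> p \<noteq> 0"
    using assms(2) by simp
  define t where "t = ((u \<bullet> f) * (p \<bullet> e) - (u \<bullet> e) * (p \<bullet> f)) / (p \<bullet> p)"
  have "t * (p \<bullet> p) = (u \<bullet> f) * (p \<bullet> e) - (u \<bullet> e) * (p \<bullet> f)"
    unfolding t_def using \<open>p \<bullet> p \<noteq> 0\<close> by simp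
  then have "(u \<bullet> e) * (p \<bullet> p) = - t * (p \<bullet> f) * (p \<bullet> p)"
    "(u \<bullet> f) * (p \<bullet> p) = t * (p \<bullet> e) * (p \<bullet> p)"
    using o n by algebra+
  then have "u \<bullet> e = - t * (p \<bullet> f)" "u \<bullet> f = t * (p \<bullet> e)"
    using \<open>p \<bullet> p \<noteq> 0\<close> mult_right_cancel by blast+
  then have "u = t *\<^sub>R quarter_turn e f p"
    by (intro frame_eqI[OF assms(1)]) (simp_all add: fr)
  then show ?thesis
    using that by blast
qed

section \<open>Scaled rotations leave a quadrant in bounded time\<close>

text \<open>The slope \<open>(x \<bullet> h) / (x \<bullet> g)\<close> grows by at least \<open>\<kappa>\<close> in each step, whereas staying in the
quadrant forces it to remain at most \<open>\<rho> / \<kappa>\<close>. Hence about \<open>\<rho> / \<kappa>\<^sup>2\<close> steps suffice to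
leave \<open>W\<close> or to reach 0. The inequalities are multiplied out because \<open>x \<bullet> g\<close> may vanish.\<close>

lemma uniformly_finite_ccw_rotation:
  fixes T :: "real^2 \<Rightarrow> real^2"
  assumes fr: "frame g h" and "0 \<in> Fix T" and \<kappa>: "\<kappa> > 0" and \<rho>: "0 \<le> \<rho>" "\<rho> \<le> 1"
    and quad: "\<And>x. x \<in> W \<Longrightarrow> 0 \<le> x \<bullet> g \<and> 0 \<le> x \<bullet> h"
    and rot: "\<And>x. x \<in> W \<Longrightarrow> T x \<bullet> g = \<rho> * (x \<bullet> g) - \<kappa> * (x \<bullet> h)"
      "\<And>x. x \<in> W \<Longrightarrow> T x \<bullet> h = \<rho> * (x \<bullet> h) + \<kappa> * (x \<bullet> g)"
    and image: "\<And>x. x \<in> W \<Longrightarrow> T x \<in> W \<union> S" and S: "uniformly_finite T S"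
  shows "uniformly_finite T W"
proof -
  obtain m where m: "\<forall>x\<in>S. (T ^^ m) x \<in> Fix T"
    using S unfolding uniformly_finite_def by blast
  obtain N :: nat where N: "\<rho> / \<kappa>\<^sup>2 < real N"
    using reals_Archimedean2 by blast
  have slope: "(\<forall>j\<le>k. (T ^^ j) x \<in> W) \<Longrightarrow>
      real k * \<kappa> * ((T ^^ k) x \<bullet> g) \<le> (T ^^ k) x \<bullet> h" for x k
  proof (induction k)
    case 0
    then show ?case using quad by auto
  next
    case (Suc k)
    define z where "z = (T ^^ k) x"
    define s where "s = real k * \<kappa>"
    have zW: "z \<in> W" and "T z \<in> W"
      using Suc.prems by (auto simp: z_def le_Suc_eq)
    have IH: "s * (z \<bullet> g) \<le> z \<bullet> h" "0 \<le> s" "0 \<le> z \<bullet> g" "0 \<le> z \<bullet> h"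
      using Suc quad zW \<kappa> by (auto simp: z_def s_def)
    have "0 \<le> (z \<bullet> h - s * (z \<bullet> g)) * (\<rho> + \<kappa> * (s + \<kappa>))
        + (z \<bullet> g) * (\<kappa> * s * (s + \<kappa>) + \<kappa> * (1 - \<rho>))"
      using IH \<kappa> \<rho> by (intro add_nonneg_nonneg mult_nonneg_nonneg) auto
    then have "(s + \<kappa>) * (T z \<bullet> g) \<le> T z \<bullet> h"
      unfolding rot[OF zW] by (simp add: algebra_simps)
    then show ?case
      by (simp add: z_def s_def algebra_simps)
  qed
  have "(T ^^ (N + 1 + m)) x \<in> Fix T" if xW: "x \<in> W" for x
  proof (cases "\<forall>j\<le>Suc N. (T ^^ j) x \<in> W")
    case True
    define z where "z = (T ^^ N) x"
    have zW: "z \<in> W" and TzW: "T z \<in> W"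
      using True by (auto simp: z_def dest: spec[of _ N] spec[of _ "Suc N"])
    have 1: "real N * \<kappa> * (z \<bullet> g) \<le> z \<bullet> h"
      unfolding z_def by (rule slope) (use True in auto)
    have 2: "\<kappa> * (z \<bullet> h) \<le> \<rho> * (z \<bullet> g)"
      using quad[OF TzW] rot(1)[OF zW] by simp
    have 3: "\<rho> < real N * \<kappa>\<^sup>2"
      using N \<kappa> by (simp add: field_simps)
    have "real N * \<kappa>\<^sup>2 * (z \<bullet> g) \<le> \<rho> * (z \<bullet> g)"
      using order.trans[OF mult_left_mono[OF 1, of \<kappa>] 2] \<kappa>
      by (simp add: power2_eq_square algebra_simps)
    then have "z \<bullet> g = 0"
      using 3 quad[OF zW] by (smt (verit) mult_strict_right_mono)
    moreover have "z \<bullet> h = 0"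
      using calculation 2 quad[OF zW] \<kappa> by (simp add: mult_le_0_iff)
    ultimately have "z = 0"
      by (intro frame_eqI[OF fr]) auto
    then have "(T ^^ N) x \<in> Fix T"
      using assms(2) z_def by simp
    then show ?thesis
      by (rule funpow_Fix_mono) simp
  next
    case False
    define j where "j = (LEAST j. (T ^^ j) x \<notin> W)"
    obtain l where l: "l \<le> Suc N" "(T ^^ l) x \<notin> W"
      using False by blast
    have j: "(T ^^ j) x \<notin> W"
      unfolding j_def by (rule LeastI, rule l(2))
    have before: "(T ^^ i) x \<in> W" if "i < j" for i
      using not_less_Least[of i "\<lambda>j. (T ^^ j) x \<notin> W"] that unfolding j_def by blast
    have "j \<le> Suc N"
      using Least_le[of "\<lambda>j. (T ^^ j) x \<notin> W", OF l(2)] l(1) unfolding j_def by simp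
    have "j \<noteq> 0"
      using j xW by (intro notI) simp
    then obtain i where i: "j = Suc i"
      using not0_implies_Suc by blast
    have "(T ^^ j) x \<in> S"
      using image[OF before[of i]] j i by auto
    then have "(T ^^ (m + j)) x \<in> Fix T"
      using m by (simp add: funpow_add)
    then show ?thesis
      by (rule funpow_Fix_mono) (use \<open>j \<le> Suc N\<close> in simp)
  qed
  then show ?thesis
    unfolding uniformly_finite_def by blast
qed

text \<open>For lines spanned by unit vectors with cosine \<open>c\<close> and sine \<open>\<sigma>\<close> between them, the operator is
\<open>c\<close> times the rotation with this angle: \<open>\<rho> = c\<^sup>2\<close> and \<open>\<kappa> = c \<sigma>\<close> above. A clockwise
rotation is turned into a counterclockwise one by swapping the frame vectors; if \<open>c \<sigma> = 0\<close>,
the operator is 0 or the identity.\<close>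

lemma uniformly_finite_two_lines:
  fixes T :: "real^2 \<Rightarrow> real^2"
  assumes fr: "frame g h" and T0: "0 \<in> Fix T" and ab: "a \<bullet> a = 1" "b \<bullet> b = 1"
    and quad: "\<And>x. x \<in> W \<Longrightarrow> 0 \<le> x \<bullet> g \<and> 0 \<le> x \<bullet> h"
    and T: "\<And>x. x \<in> W \<Longrightarrow> T x = x - (x \<bullet> a) *\<^sub>R a + ((2 *\<^sub>R (x \<bullet> a) *\<^sub>R a - x) \<bullet> b) *\<^sub>R b"
    and image: "\<And>x. x \<in> W \<Longrightarrow> T x \<in> W \<union> S" and S: "uniformly_finite T S"
  shows "uniformly_finite T W"
proof -
  define c where "c = a \<bullet> b"
  define \<sigma> where "\<sigma> = (a \<bullet> g) * (b \<bullet> h) - (a \<bullet> h) * (b \<bullet> g)"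
  note exp = inner_frame[OF fr]
  have n: "(a \<bullet> g) * (a \<bullet> g) + (a \<bullet> h) * (a \<bullet> h) = 1"
    "(b \<bullet> g) * (b \<bullet> g) + (b \<bullet> h) * (b \<bullet> h) = 1"
    "c = (a \<bullet> g) * (b \<bullet> g) + (a \<bullet> h) * (b \<bullet> h)"
    using ab exp[of a a] exp[of b b] exp[of a b] by (auto simp: c_def)
  have unit: "c * c + \<sigma> * \<sigma> = 1"
    unfolding \<sigma>_def n(3) using n(1,2) by algebra
  have rot: "T x \<bullet> g = c * c * (x \<bullet> g) - c * \<sigma> * (x \<bullet> h)"
    "T x \<bullet> h = c * c * (x \<bullet> h) + c * \<sigma> * (x \<bullet> g)" if "x \<in> W" for x
  proof -
    define s where "s = x \<bullet> a"
    define d where "d = 2 * s * c - x \<bullet> b"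
    have s: "s = (x \<bullet> g) * (a \<bullet> g) + (x \<bullet> h) * (a \<bullet> h)"
      "d = 2 * s * c - ((x \<bullet> g) * (b \<bullet> g) + (x \<bullet> h) * (b \<bullet> h))"
      unfolding s_def d_def using exp by metis+
    have Tx: "T x = x - s *\<^sub>R a + d *\<^sub>R b"
      unfolding T[OF that] s_def d_def c_def by (simp add: inner_diff_left)
    show "T x \<bullet> g = c * c * (x \<bullet> g) - c * \<sigma> * (x \<bullet> h)"
      "T x \<bullet> h = c * c * (x \<bullet> h) + c * \<sigma> * (x \<bullet> g)"
      unfolding Tx inner_add_left inner_diff_left inner_scaleR_left s n(3) \<sigma>_def
      using n(1,2) by algebra+
  qed
  have c1: "c * c \<le> 1"
    using unit by (smt (verit) zero_le_square)
  consider "c * \<sigma> > 0" | "c * \<sigma> < 0" | "c = 0" | "\<sigma> = 0"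
    by (metis linorder_neqE_linordered_idom mult_eq_0_iff)
  then show ?thesis
  proof cases
    case 1
    show ?thesis
      using uniformly_finite_ccw_rotation[OF fr T0 1 _ c1 quad rot image S] by simp
  next
    case 2
    then have "- (c * \<sigma>) > 0"
      by simp
    from uniformly_finite_ccw_rotation[OF frame_swap[OF fr] T0 this _ c1 _ _ _ image S]
    show ?thesis
      using rot quad by simp
  next
    case 3
    then have "T x = 0" if "x \<in> W" for x
      using rot[OF that] by (intro frame_eqI[OF fr]) auto
    then show ?thesis
      using T0 by (intro uniformly_finite_step[OF uniformly_finite_Fix[of "{0}"]]) auto
  next
    case 4
    then have "T x = x" if "x \<in> W" for x
      using rot[OF that] unit by (intro frame_eqI[OF fr]) auto
    then show ?thesis
      by (intro uniformly_finite_Fix) (auto simp: Fix_def)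
  qed
qed

section \<open>Projections onto closed convex cones\<close>

locale closed_convex_cone =
  fixes C :: "(real^2) set"
  assumes closed: "closed C" and convex: "convex C" and pos_cone: "pos_cone C"
    and nonempty: "C \<noteq> {}"
begin

abbreviation "P \<equiv> closest_point C"

lemma P_mem: "P x \<in> C"
  using closest_point_in_set closed nonempty by blast

lemma add_mem:
  assumes "x \<in> C" "y \<in> C"
  shows "x + y \<in> C"
proof -
  have "2 *\<^sub>R x \<in> C" "2 *\<^sub>R y \<in> C"
    using assms pos_cone by (auto simp: pos_cone_def)
  then have "(1/2) *\<^sub>R 2 *\<^sub>R x + (1/2) *\<^sub>R 2 *\<^sub>R y \<in> C"
    using convex by (intro convexD) auto
  then show ?thesis
    by simp
qed

text \<open>The following facts are Moreau's decomposition: the residual \<open>x - P x\<close> is orthogonal to \<open>P x\<close>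
and belongs to the polar cone, and this characterises \<open>P x\<close>.\<close>

lemma P_dot: "z \<in> C \<Longrightarrow> (x - P x) \<bullet> (z - P x) \<le> 0"
  using closest_point_dot[OF convex closed] .

lemma P_orth: "(x - P x) \<bullet> P x = 0"
proof -
  have "2 *\<^sub>R P x \<in> C" "(1/2) *\<^sub>R P x \<in> C"
    using P_mem[of x] pos_cone by (auto simp: pos_cone_def)
  from P_dot[OF this(1), of x] P_dot[OF this(2), of x] show ?thesis
    by (simp add: inner_diff_right algebra_simps)
qed

lemma P_polar: "z \<in> C \<Longrightarrow> (x - P x) \<bullet> z \<le> 0"
  using P_dot[OF add_mem[OF P_mem], of z x x] by simp

lemma zero_mem: "0 \<in> C"
  using P_orth[of 0] P_mem[of 0] by simp

lemma scale_mem: "x \<in> C \<Longrightarrow> c \<ge> 0 \<Longrightarrow> c *\<^sub>R x \<in> C"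
  using pos_cone zero_mem by (cases "c = 0") (auto simp: pos_cone_def)

lemma comb_mem: "x \<in> C \<Longrightarrow> y \<in> C \<Longrightarrow> s \<ge> 0 \<Longrightarrow> t \<ge> 0 \<Longrightarrow> s *\<^sub>R x + t *\<^sub>R y \<in> C"
  by (intro add_mem scale_mem)

lemma P_eqI:
  assumes "p \<in> C" "(x - p) \<bullet> p = 0" "\<And>z. z \<in> C \<Longrightarrow> (x - p) \<bullet> z \<le> 0"
  shows "P x = p"
proof (rule closest_point_unique[symmetric, OF convex closed assms(1)], intro ballI)
  fix z assume "z \<in> C"
  have "0 \<le> (p - z) \<bullet> (p - z)"
    by simp
  with assms(2) assms(3)[OF \<open>z \<in> C\<close>] have "(x - p) \<bullet> (x - p) \<le> (x - z) \<bullet> (x - z)"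
    by (simp add: inner_diff_left inner_diff_right inner_commute algebra_simps)
  then show "dist x p \<le> dist x z"
    by (simp add: dist_norm norm_le)
qed

lemma P_self: "x \<in> C \<Longrightarrow> P x = x"
  by (rule closest_point_self)

text \<open>In the plane, a point at an angle of at most a right angle to some vector \<open>z\<close> of the cone is
projected into the sector between \<open>z\<close> and the point: the component along \<open>z\<close> does not decrease,
and then orthogonality of the residual to the projection forces the component across \<open>z\<close> to
shrink without changing its sign. This is how a projection onto one cone is seen to stay inside the
other one.\<close>

lemma P_between:
  assumes "z \<in> C" "z \<noteq> 0" "0 \<le> x \<bullet> z"
  obtains l m where "l \<ge> 0" "m \<ge> 0" "P x = l *\<^sub>R z + m *\<^sub>R x"
proof -
  define n where "n = norm z"
  have n: "n > 0"
    using assms(2) by (simp add: n_def)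
  define e where "e = (1/n) *\<^sub>R z"
  have "e \<bullet> e = 1"
    using assms(2) by (simp add: e_def n_def dot_square_norm power2_eq_square)
  then obtain f0 where f0: "frame e f0"
    using frame_exists by blast
  obtain f where fr: "frame e f" and xf: "0 \<le> x \<bullet> f"
    using f0 frame_minus[OF f0] by (metis inner_minus_right le_cases neg_0_le_iff_le)
  have z: "z = n *\<^sub>R e"
    using n by (simp add: e_def)
  have xe: "0 \<le> x \<bullet> e" and eC: "e \<in> C"
    using assms n by (auto simp: e_def intro: scale_mem)
  define p where "p = P x"
  have e: "x \<bullet> e \<le> p \<bullet> e"
    using P_polar[OF eC, of x] by (simp add: inner_diff_left p_def)
  have o: "(x \<bullet> e - p \<bullet> e) * (p \<bullet> e) + (x \<bullet> f - p \<bullet> f) * (p \<bullet> f) = 0"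
    using P_orth[of x] inner_frame[OF fr, of "x - p" p] by (simp add: inner_diff_left p_def)
  have "\<exists>l\<ge>0. \<exists>m\<ge>0. p = l *\<^sub>R e + m *\<^sub>R x"
  proof (cases "p \<bullet> f = 0")
    case True
    then have "p = (p \<bullet> e) *\<^sub>R e + 0 *\<^sub>R x"
      by (intro frame_eqI[OF fr]) (auto simp: frame_inner_simps[OF fr])
    then show ?thesis
      using e xe by (metis order.refl order.trans)
  next
    case False
    have "0 \<le> (p \<bullet> e - x \<bullet> e) * (p \<bullet> e)"
      using e xe by (intro mult_nonneg_nonneg) auto
    then have "0 \<le> (x \<bullet> f - p \<bullet> f) * (p \<bullet> f)"
      using o by (simp add: algebra_simps)
    then have pf: "0 < p \<bullet> f" "p \<bullet> f \<le> x \<bullet> f"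
      using False xf by (auto simp: zero_le_mult_iff)
    define m where "m = (p \<bullet> f) / (x \<bullet> f)"
    have m: "0 \<le> m" "m \<le> 1" "m * (x \<bullet> f) = p \<bullet> f"
      using pf by (auto simp: m_def field_simps)
    have "p = (p \<bullet> e - m * (x \<bullet> e)) *\<^sub>R e + m *\<^sub>R x"
      using m by (intro frame_eqI[OF fr]) (auto simp: frame_inner_simps[OF fr] inner_add_left)
    moreover have "m * (x \<bullet> e) \<le> 1 * (x \<bullet> e)"
      using m xe by (intro mult_right_mono) auto
    ultimately show ?thesis
      using e m(1) by (metis diff_ge_0_iff_ge mult_1 order.trans)
  qed
  then obtain l m where "l \<ge> 0" "m \<ge> 0" "p = l *\<^sub>R e + m *\<^sub>R x"
    by blast
  then have "P x = (l / n) *\<^sub>R z + m *\<^sub>R x"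
    by (simp add: p_def e_def)
  then show ?thesis
    using that[of "l / n" m] \<open>l \<ge> 0\<close> \<open>m \<ge> 0\<close> n by auto
qed

text \<open>All points outside the cone on the counterclockwise side of their projection have their projection
on one line: if \<open>p\<close> and \<open>q\<close> are two such projections, their quarter turns are polar to
the cone, so both \<open>q \<bullet> J p\<close> and \<open>p \<bullet> J q = - (q \<bullet> J p)\<close> are at most 0, whence \<open>p\<close> and \<open>q\<close> are
parallel. This gives a single rotation for a whole phase.\<close>

lemma P_same_edge:
  assumes fr: "frame e f"
    and x: "P x \<noteq> 0" "x - P x = t *\<^sub>R quarter_turn e f (P x)" "t > 0"
    and x0: "P x0 \<noteq> 0" "x0 - P x0 = t0 *\<^sub>R quarter_turn e f (P x0)" "t0 > 0"
    and a: "a = (1 / norm (P x0)) *\<^sub>R P x0"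
  shows "P x = (x \<bullet> a) *\<^sub>R a"
proof -
  define p where "p = P x"
  define q where "q = P x0"
  have "q \<bullet> quarter_turn e f p \<le> 0" "p \<bullet> quarter_turn e f q \<le> 0"
    using P_polar[of q x] P_polar[of p x0] P_mem x(2,3) x0(2,3)
    by (auto simp: p_def q_def inner_commute mult_le_0_iff)
  then have "quarter_turn e f q \<bullet> p = 0"
    by (simp add: inner_quarter_turn[OF fr] inner_commute[of _ p] algebra_simps)
  moreover have "quarter_turn e f (quarter_turn e f q) = - q"
    by (intro frame_eqI[OF fr]) (simp_all add: frame_inner_simps[OF fr])
  moreover have "quarter_turn e f q \<noteq> 0"
    using calculation(2) x0(1) by (auto simp: q_def quarter_turn_def)
  ultimately obtain s where "p = s *\<^sub>R - q"
    using orthogonal_quarter_turn[OF fr, of "quarter_turn e f q" p] by (metis inner_commute)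
  then have p: "p = (- s * norm q) *\<^sub>R a"
    using x0(1) by (simp add: a q_def)
  have aa: "a \<bullet> a = 1"
    using x0(1) by (simp add: a dot_square_norm power2_eq_square)
  have "(x - p) \<bullet> p = 0"
    using P_orth by (simp add: p_def)
  moreover have "- s * norm q \<noteq> 0"
    using x(1) p by (auto simp: p_def)
  ultimately have "(x - p) \<bullet> a = 0"
    by (metis p inner_scaleR_right mult_eq_0_iff)
  then have "x \<bullet> a = - s * norm q"
    using aa by (subst (asm) p) (simp add: inner_diff_left inner_add_left)
  then show ?thesis
    using p by (simp add: p_def)
qed

end

section \<open>Cones with a common ray\<close>

text \<open>The last assumption excludes exactly the case that \<open>A\<close> is the line through \<open>e\<close>.\<close>

locale cone_pair = A: closed_convex_cone A + B: closed_convex_cone B for A B +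
  fixes e f :: "real^2"
  assumes frame: "frame e f" and e_mem: "e \<in> A" "e \<in> B"
    and not_line: "- e \<in> A \<Longrightarrow> \<exists>w\<in>A. w \<bullet> f \<noteq> 0"
begin

abbreviation "T \<equiv> T_DR A B"
abbreviation "J \<equiv> quarter_turn e f"
abbreviation "R \<equiv> reflector A"

lemmas fr = frame_inner_simps[OF frame]

lemma T_eq: "T x = x - A.P x + B.P (R x)"
proof -
  have "(1/2) *\<^sub>R (x + (2 *\<^sub>R b - r)) = x - p + b" if "r = 2 *\<^sub>R p - x" for b r p :: "real^2"
    by (simp add: that vec_eq_iff)
  from this[OF reflector_def[of A x]] show ?thesis
    unfolding T_DR_def comp_apply reflector_def[of B "R x"] .
qed

lemma T_eq': "T x = A.P x - (R x - B.P (R x))"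
  by (simp add: T_eq reflector_def scaleR_2)

lemma T_on_A: "x \<in> A \<Longrightarrow> T x = B.P x"
  by (simp add: T_eq A.P_self reflector_def scaleR_2)

lemma Fix_Int: "x \<in> A \<Longrightarrow> x \<in> B \<Longrightarrow> x \<in> Fix T"
  by (simp add: Fix_def T_on_A B.P_self)

lemma zero_Fix: "0 \<in> Fix T"
  by (intro Fix_Int A.zero_mem B.zero_mem)

lemma P_forward: "x \<bullet> e \<le> A.P x \<bullet> e"
  using A.P_polar[OF e_mem(1), of x] by (simp add: inner_diff_left)

lemma PB_forward: "x \<bullet> e \<le> B.P x \<bullet> e"
  using B.P_polar[OF e_mem(2), of x] by (simp add: inner_diff_left)

lemma T_forward: "A.P x \<bullet> e \<le> T x \<bullet> e"
  using PB_forward[of "R x"] by (simp add: T_eq' inner_diff_left)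

text \<open>From \<open>x \<in> A\<close> in the forward half-plane, the projection onto \<open>B\<close> stays in the sector between
\<open>e\<close> and \<open>x\<close>, hence in \<open>A\<close>.\<close>

lemma T_right_A:
  assumes "x \<in> A" "0 \<le> x \<bullet> e"
  shows "T x \<in> Fix T"
proof -
  have "e \<noteq> 0"
    using fr(1) by auto
  from B.P_between[OF e_mem(2) this assms(2)] have "B.P x \<in> A"
    by (metis A.comb_mem e_mem(1) assms(1))
  then show ?thesis
    using assms B.P_mem by (simp add: T_on_A Fix_Int)
qed

lemmas inner_J = inner_quarter_turn[OF frame]

text \<open>If \<open>p\<close> is on the counterclockwise edge of \<open>A\<close>, then \<open>A\<close> contains the sector of the upper half-plane
that lies clockwise of \<open>p\<close>. For \<open>p \<bullet> f > 0\<close> it is spanned by \<open>e\<close> and \<open>p\<close>. For \<open>p\<close> opposite to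
\<open>e\<close> it is the whole open upper half-plane, and this is where \<open>A\<close> must not be a line.\<close>

lemma below_edge_mem:
  assumes p: "p \<in> A" "\<And>w. w \<in> A \<Longrightarrow> w \<bullet> J p \<le> 0"
    and z: "0 \<le> z \<bullet> f" "z \<bullet> J p < 0"
  shows "z \<in> A"
proof -
  have "0 \<le> p \<bullet> f"
    using p(2)[OF e_mem(1)] by (simp add: inner_J fr)
  show ?thesis
  proof (cases "p \<bullet> f = 0")
    case False
    then have pf: "p \<bullet> f > 0"
      using \<open>0 \<le> p \<bullet> f\<close> by simp
    have "z = (- (z \<bullet> J p) / (p \<bullet> f)) *\<^sub>R e + ((z \<bullet> f) / (p \<bullet> f)) *\<^sub>R p"
      using pf by (intro frame_eqI[OF frame]) (simp_all add: inner_J fr inner_add_left field_simps)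
    also have "\<dots> \<in> A"
      using z pf by (intro A.comb_mem e_mem p) (auto intro: divide_nonpos_pos)
    finally show ?thesis .
  next
    case True
    then have "(z \<bullet> f) * (p \<bullet> e) < 0"
      using z(2) by (simp add: inner_J)
    then have pe: "p \<bullet> e < 0"
      using z(1) by (auto simp: mult_less_0_iff)
    have me: "- e \<in> A"
    proof -
      have "- e = (1 / - (p \<bullet> e)) *\<^sub>R p"
        using pe True by (intro frame_eqI[OF frame]) (auto simp: fr)
      also have "\<dots> \<in> A"
        using pe by (intro A.scale_mem p) auto
      finally show ?thesis .
    qed
    then obtain w where w: "w \<in> A" "w \<bullet> f \<noteq> 0"
      using not_line by blast
    have "(w \<bullet> f) * (p \<bullet> e) \<le> 0"
      using p(2)[OF w(1)] True by (simp add: inner_J)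
    then have wf: "0 < w \<bullet> f"
      using pe w(2) by (auto simp: mult_le_0_iff)
    define k where "k = z \<bullet> e - (z \<bullet> f) / (w \<bullet> f) * (w \<bullet> e)"
    have z': "z = k *\<^sub>R e + ((z \<bullet> f) / (w \<bullet> f)) *\<^sub>R w"
      using wf by (intro frame_eqI[OF frame]) (simp_all add: k_def fr inner_add_left)
    have "k *\<^sub>R e \<in> A"
      using A.scale_mem[OF e_mem(1), of k] A.scale_mem[OF me, of "- k"] by (cases "k \<ge> 0") auto
    then show ?thesis
      using wf z(1) A.add_mem[OF _ A.scale_mem[OF w(1)]] by (subst z') simp
  qed
qed

lemma edge_polar:
  assumes "x - A.P x = t *\<^sub>R J (A.P x)" "t > 0" "w \<in> A"
  shows "w \<bullet> J (A.P x) \<le> 0"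
  using A.P_polar[OF assms(3), of x] assms(1,2) by (simp add: inner_commute mult_le_0_iff)

lemma edge_up:
  assumes "x - A.P x = t *\<^sub>R J (A.P x)" "t > 0"
  shows "0 \<le> A.P x \<bullet> f"
  using edge_polar[OF assms e_mem(1)] by (simp add: inner_J fr)

lemma R_eq: "R x = A.P x - (x - A.P x)"
  by (simp add: reflector_def scaleR_2)

text \<open>Reflecting \<open>x\<close> past the edge \<open>p\<close> to \<open>y = 2p - x\<close> and projecting \<open>y\<close> further clockwise to \<open>b\<close>, the
rotation brings \<open>x\<close> into the sector spanned by \<open>b\<close> and \<open>p\<close>. This sector lies in \<open>A\<close>, so the next
step is the projection onto \<open>B\<close>, which remains between \<open>b\<close> and \<open>T x\<close>.\<close>

lemma cw_two_steps:
  assumes p: "A.P x \<noteq> 0" "x - A.P x = t *\<^sub>R J (A.P x)" "t > 0"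
    and b: "B.P (R x) \<noteq> 0" "R x - B.P (R x) = r *\<^sub>R J (B.P (R x))" "r > 0"
    and acute: "0 \<le> B.P (R x) \<bullet> A.P x"
  shows "T (T x) \<in> Fix T"
proof -
  define p where "p = A.P x"
  define b where "b = B.P (R x)"
  define w where "w = b \<bullet> p"
  define D where "D = - (b \<bullet> J p)"
  note exp = inner_frame[OF frame]
  have "R x = p - t *\<^sub>R J p" "R x = b + r *\<^sub>R J b"
    using p(2) b(2) by (simp_all add: R_eq p_def b_def algebra_simps)
  then have "p - t *\<^sub>R J p = b + r *\<^sub>R J b"
    by simp
  then have "(p - t *\<^sub>R J p) \<bullet> e = (b + r *\<^sub>R J b) \<bullet> e"
    "(p - t *\<^sub>R J p) \<bullet> f = (b + r *\<^sub>R J b) \<bullet> f"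
    by simp_all
  then have y: "p \<bullet> e + t * (p \<bullet> f) = b \<bullet> e - r * (b \<bullet> f)"
    "p \<bullet> f - t * (p \<bullet> e) = b \<bullet> f + r * (b \<bullet> e)"
    by (simp_all add: inner_diff_left inner_add_left fr)
  have w: "w = (b \<bullet> e) * (p \<bullet> e) + (b \<bullet> f) * (p \<bullet> f)"
    unfolding w_def by (rule exp)
  have D': "D = (b \<bullet> e) * (p \<bullet> f) - (b \<bullet> f) * (p \<bullet> e)"
    by (simp add: D_def inner_J)
  have bb: "b \<bullet> b = (b \<bullet> e) * (b \<bullet> e) + (b \<bullet> f) * (b \<bullet> f)"
    by (rule exp)
  have "D = r * (b \<bullet> b) + t * w"
    unfolding D' w bb using y by algebra
  moreover have "b \<bullet> b > 0" "w \<ge> 0"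
    using assms by (auto simp: b_def w_def p_def)
  ultimately have D: "D > 0"
    using assms(3,6) by (simp add: add_pos_nonneg)
  have "0 \<le> b \<bullet> f"
    using B.P_polar[OF e_mem(2), of "R x"] b(2,3) by (simp add: b_def fr zero_le_mult_iff)
  moreover have "b \<bullet> J p < 0"
    using D by (simp add: D_def)
  ultimately have bA: "b \<in> A"
    using below_edge_mem[OF A.P_mem edge_polar[OF p(2,3)]] by (simp add: p_def)
  have Tx: "T x = p - r *\<^sub>R J b"
    using b(2) by (simp add: T_eq' p_def b_def)
  \<comment> \<open>Coordinates of \<open>T x\<close> in the basis \<open>b, p\<close> by Cramer's rule, where \<open>D\<close> is the determinant
    of \<open>b\<close> and \<open>p\<close>.\<close>
  have "D * (p \<bullet> e + r * (b \<bullet> f)) = r * w * (b \<bullet> e) + t * w * (p \<bullet> e)"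
    "D * (p \<bullet> f - r * (b \<bullet> e)) = r * w * (b \<bullet> f) + t * w * (p \<bullet> f)"
    unfolding D' w using y by algebra+
  then have "D *\<^sub>R T x = (r * w) *\<^sub>R b + (t * w) *\<^sub>R p"
    by (intro frame_eqI[OF frame]) (simp_all add: Tx inner_diff_left inner_add_left fr)
  moreover have "T x = (1 / D) *\<^sub>R (D *\<^sub>R T x)"
    using D by simp
  ultimately have TA: "T x \<in> A"
    using D \<open>w \<ge> 0\<close> p(3) b(3) bA A.P_mem[of x]
    by (metis A.comb_mem A.scale_mem less_imp_le mult_nonneg_nonneg p_def zero_le_divide_1_iff)
  have "J b \<bullet> b = 0"
    using inner_J[of b b] by (simp add: inner_commute)
  then have "0 \<le> T x \<bullet> b"
    using \<open>w \<ge> 0\<close> by (simp add: Tx inner_diff_left w_def inner_commute[of p b])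
  from B.P_between[OF _ _ this] have "B.P (T x) \<in> A"
    using TA bA b(1) B.P_mem[of "R x"] by (metis A.comb_mem b_def)
  then show ?thesis
    using B.P_mem by (simp add: T_on_A[OF TA] Fix_Int)
qed

text \<open>On this set \<open>x\<close> is counterclockwise of its projection and \<open>2p - x\<close> is clockwise of
  its own, both projections being nonzero. Here \<open>T\<close> is one fixed scaled rotation.\<close>

definition rotating :: "(real^2) set" where
  "rotating = {x. A.P x \<noteq> 0 \<and> (\<exists>t>0. x - A.P x = t *\<^sub>R J (A.P x)) \<and>
     B.P (R x) \<noteq> 0 \<and> (\<exists>r<0. R x - B.P (R x) = r *\<^sub>R J (B.P (R x)))}"

lemma rotating_edges:
  assumes x0: "x0 \<in> rotating"
  defines "a \<equiv> (1 / norm (A.P x0)) *\<^sub>R A.P x0"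
  obtains b where "a \<bullet> a = 1" "b \<bullet> b = 1" "\<And>x. x \<in> rotating \<Longrightarrow> A.P x = (x \<bullet> a) *\<^sub>R a"
    "\<And>x. x \<in> rotating \<Longrightarrow>
       T x = x - (x \<bullet> a) *\<^sub>R a + ((2 *\<^sub>R (x \<bullet> a) *\<^sub>R a - x) \<bullet> b) *\<^sub>R b"
proof -
  define b where "b = (1 / norm (B.P (R x0))) *\<^sub>R B.P (R x0)"
  have J': "quarter_turn e (- f) z = - J z" for z
    by (simp add: quarter_turn_def)
  have unit: "a \<bullet> a = 1" "b \<bullet> b = 1"
    using x0 by (simp_all add: rotating_def a_def b_def dot_square_norm power2_eq_square)
  have Pa: "A.P x = (x \<bullet> a) *\<^sub>R a" if "x \<in> rotating" for x
    using A.P_same_edge[OF frame, of x _ x0 _ a] that x0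
    by (auto simp: rotating_def a_def)
  have neg: "\<exists>t>0. z = t *\<^sub>R - w" if "\<exists>r<0. z = r *\<^sub>R w" for z w :: "real^2"
    using that by (metis neg_0_less_iff_less scaleR_minus_left scaleR_minus_right minus_minus)
  have Pb: "B.P (R x) = (R x \<bullet> b) *\<^sub>R b" if x: "x \<in> rotating" for x
  proof -
    obtain t t0 where
      "t > 0" "R x - B.P (R x) = t *\<^sub>R quarter_turn e (- f) (B.P (R x))"
      "t0 > 0" "R x0 - B.P (R x0) = t0 *\<^sub>R quarter_turn e (- f) (B.P (R x0))"
      using x x0 unfolding J' rotating_def by (auto dest!: neg)
    then show ?thesis
      using B.P_same_edge[OF frame_minus[OF frame], of "R x" t "R x0" t0 b] x x0
      by (auto simp: rotating_def b_def)
  qed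
  have "T x = x - (x \<bullet> a) *\<^sub>R a + ((2 *\<^sub>R (x \<bullet> a) *\<^sub>R a - x) \<bullet> b) *\<^sub>R b" if "x \<in> rotating" for x
    unfolding T_eq Pb[OF that] by (simp add: reflector_def Pa[OF that, symmetric])
  then show ?thesis
    using that[OF unit Pa] by blast
qed

lemma turn_cases:
  assumes "B.P (R x) \<noteq> 0"
  obtains "R x = B.P (R x)"
  | r where "r > 0" "R x - B.P (R x) = r *\<^sub>R J (B.P (R x))"
  | r where "r < 0" "R x - B.P (R x) = r *\<^sub>R J (B.P (R x))"
proof -
  obtain r where r: "R x - B.P (R x) = r *\<^sub>R J (B.P (R x))"
    using orthogonal_quarter_turn[OF frame assms B.P_orth] by blast
  consider "r = 0" | "r > 0" | "r < 0"
    by linarith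
  then show ?thesis
    using r that by cases auto
qed

subsection \<open>Forward half-plane\<close>

text \<open>In the open forward quadrant \<open>x\<close> can only be counterclockwise of its projection, and a clockwise
turn in \<open>B\<close> followed by the step keeps the point in this quadrant.\<close>

lemma quadrant_cases:
  assumes x: "0 < x \<bullet> e" "0 \<le> x \<bullet> f"
  shows "T (T x) \<in> Fix T \<or> x \<in> rotating \<and> 0 < T x \<bullet> e \<and> 0 \<le> T x \<bullet> f"
proof (cases "x \<in> A")
  case True
  then show ?thesis
    using T_right_A[of x] x(1) by (auto simp: Fix_def)
next
  case False
  have pe: "0 < A.P x \<bullet> e"
    using P_forward[of x] x(1) by simp
  then have p0: "A.P x \<noteq> 0"
    by auto
  obtain t where t: "x - A.P x = t *\<^sub>R J (A.P x)"
    using orthogonal_quarter_turn[OF frame p0 A.P_orth] by blast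
  have "t \<noteq> 0"
    using False A.P_mem[of x] t by auto
  have xf: "x \<bullet> f = A.P x \<bullet> f + t * (A.P x \<bullet> e)"
    using arg_cong[OF t, of "\<lambda>z. z \<bullet> f"] by (simp add: inner_diff_left fr)
  have "0 \<le> t * (A.P x \<bullet> f)"
    using A.P_polar[OF e_mem(1), of x] by (simp add: t fr)
  \<comment> \<open>Otherwise \<open>p \<bullet> f \<le> 0\<close>, and \<open>x\<close> would lie strictly below \<open>p\<close>, against \<open>x \<bullet> f \<ge> 0\<close>.\<close>
  then have t0: "t > 0"
    using \<open>t \<noteq> 0\<close> xf x(2) pe
    by (smt (verit) mult_neg_pos zero_le_mult_iff)
  have pf: "0 \<le> A.P x \<bullet> f"
    using edge_up[OF t t0] .
  have "0 < R x \<bullet> e"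
    using t t0 pf pe by (simp add: R_eq inner_diff_left fr add_pos_nonneg)
  then have be: "0 < B.P (R x) \<bullet> e"
    using PB_forward[of "R x"] by simp
  then have b0: "B.P (R x) \<noteq> 0"
    by auto
  from b0 show ?thesis
  proof (cases rule: turn_cases)
    case 1
    then have "T x = A.P x"
      by (simp add: T_eq')
    then show ?thesis
      using T_right_A[OF A.P_mem] pe by simp
  next
    case (2 r)
    have "0 \<le> B.P (R x) \<bullet> f"
      using B.P_polar[OF e_mem(2), of "R x"] 2 by (simp add: fr zero_le_mult_iff)
    then have "0 \<le> B.P (R x) \<bullet> A.P x"
      using be pe pf by (subst inner_frame[OF frame]) simp
    then show ?thesis
      using cw_two_steps[OF p0 t t0 b0 2(2,1)] by simp
  next
    case (3 r)
    have "0 < T x \<bullet> e"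
      using T_forward[of x] pe by simp
    moreover have "T x \<bullet> f = A.P x \<bullet> f - r * (B.P (R x) \<bullet> e)"
      using 3(2) by (simp add: T_eq' inner_diff_left fr)
    then have "0 \<le> T x \<bullet> f"
      using pf mult_neg_pos[OF 3(1) be] by simp
    ultimately show ?thesis
      using p0 t t0 b0 3 by (auto simp: rotating_def)
  qed
qed

lemma uniformly_finite_quadrant: "uniformly_finite T {x. 0 < x \<bullet> e \<and> 0 \<le> x \<bullet> f}"
proof -
  define W where "W = {x \<in> rotating. 0 < x \<bullet> e \<and> 0 \<le> x \<bullet> f}"
  define S where "S = {x. T (T x) \<in> Fix T}"
  have S: "uniformly_finite T S"
    by (rule uniformly_finite_two_steps) (simp add: S_def)
  have sub: "x \<in> W \<union> S" if "0 < x \<bullet> e" "0 \<le> x \<bullet> f" for x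
    using quadrant_cases[OF that] that by (auto simp: W_def S_def)
  have img: "T x \<in> W \<union> S" if "x \<in> W" for x
  proof (cases "x \<in> S")
    case True
    then show ?thesis by (auto simp: S_def Fix_def)
  next
    case False
    then show ?thesis
      using quadrant_cases[of x] that by (intro sub) (auto simp: W_def S_def)
  qed
  have "uniformly_finite T W"
  proof (cases "W = {}")
    case True
    then show ?thesis
      by (simp add: uniformly_finite_def)
  next
    case False
    then obtain x0 where x0: "x0 \<in> rotating"
      by (auto simp: W_def)
    from rotating_edges[OF x0] obtain a b where ab: "a \<bullet> a = 1" "b \<bullet> b = 1"
      "\<And>x. x \<in> rotating \<Longrightarrow>
         T x = x - (x \<bullet> a) *\<^sub>R a + ((2 *\<^sub>R (x \<bullet> a) *\<^sub>R a - x) \<bullet> b) *\<^sub>R b"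
      by metis
    show ?thesis
      by (rule uniformly_finite_two_lines[OF frame zero_Fix ab(1,2) _ ab(3) img S])
        (auto simp: W_def)
  qed
  then have "uniformly_finite T (W \<union> S)"
    using S by (rule uniformly_finite_Un)
  then show ?thesis
    by (rule uniformly_finite_subset) (use sub in auto)
qed

text \<open>Mirror images: every result for points on the counterclockwise side also holds on the
clockwise side.\<close>

lemma flip: "cone_pair A B e (- f)"
proof (intro cone_pair.intro cone_pair_axioms.intro)
  show "frame e (- f)"
    using frame_minus[OF frame] .
  show "\<exists>w\<in>A. w \<bullet> - f \<noteq> 0" if "- e \<in> A"
    using not_line[OF that] by simp
qed (use e_mem A.closed_convex_cone_axioms B.closed_convex_cone_axioms in auto)

text \<open>If \<open>T x\<close> does not move into the open half-plane, then neither residual has a component along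
\<open>e\<close>, which outside \<open>A\<close> leaves only \<open>p = 0\<close> and then \<open>T x = 0\<close> or \<open>T x = x\<close>.\<close>

lemma boundary_cases:
  assumes "x \<bullet> e = 0"
  shows "0 < T x \<bullet> e \<or> T x \<in> Fix T"
proof (cases "x \<in> A")
  case True
  then show ?thesis
    using T_right_A assms by simp
next
  case False
  define p where "p = A.P x"
  define v where "v = R x - B.P (R x)"
  have ve: "v \<bullet> e \<le> 0"
    unfolding v_def by (rule B.P_polar[OF e_mem(2)])
  have Tx: "T x = p - v"
    by (simp add: T_eq' p_def v_def)
  have pe: "0 \<le> p \<bullet> e"
    using P_forward[of x] assms by (simp add: p_def)
  show ?thesis
  proof (cases "p \<bullet> e = 0 \<and> v \<bullet> e = 0")
    case False
    then show ?thesis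
      using ve pe by (auto simp: Tx inner_diff_left)
  next
    case z: True
    have "(x \<bullet> f - p \<bullet> f) * (p \<bullet> f) = 0"
      using A.P_orth[of x] inner_frame[OF frame, of "x - p" p] z assms
      by (simp add: p_def inner_diff_left)
    moreover have "x \<bullet> f \<noteq> p \<bullet> f"
      using False A.P_mem[of x] frame_eqI[OF frame, of x p] z assms by (auto simp: p_def)
    ultimately have "p = 0"
      using z by (intro frame_eqI[OF frame]) auto
    then have Rx: "R x = - x"
      by (simp add: reflector_def p_def)
    have "B.P (R x) \<bullet> e = 0"
      using z assms by (simp add: v_def Rx inner_diff_left)
    moreover have "v \<bullet> B.P (R x) = 0"
      unfolding v_def by (rule B.P_orth)
    then have "(v \<bullet> f) * (B.P (R x) \<bullet> f) = 0"
      using z inner_frame[OF frame, of v "B.P (R x)"] by simp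
    ultimately have "v = 0 \<or> B.P (R x) = 0"
      using z frame_eqI[OF frame, of v 0] frame_eqI[OF frame, of "B.P (R x)" 0] by auto
    then show ?thesis
    proof
      assume "v = 0"
      then show ?thesis
        using zero_Fix \<open>p = 0\<close> by (simp add: Tx)
    next
      assume "B.P (R x) = 0"
      then have "T x = x"
        using \<open>p = 0\<close> by (simp add: T_eq p_def)
      then show ?thesis
        by (simp add: Fix_def)
    qed
  qed
qed

lemma uniformly_finite_forward: "uniformly_finite T {x. 0 \<le> x \<bullet> e}"
proof -
  have "uniformly_finite T ({x. 0 < x \<bullet> e \<and> 0 \<le> x \<bullet> f} \<union> {x. 0 < x \<bullet> e \<and> 0 \<le> x \<bullet> - f})"
    by (intro uniformly_finite_Un uniformly_finite_quadrant
        cone_pair.uniformly_finite_quadrant[OF flip])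
  then have pos: "uniformly_finite T {x. 0 < x \<bullet> e}"
    by (rule uniformly_finite_subset) auto
  have "uniformly_finite T ({x. 0 < x \<bullet> e} \<union> Fix T)"
    by (intro uniformly_finite_Un pos uniformly_finite_Fix order.refl)
  then have "uniformly_finite T {x. x \<bullet> e = 0}"
    by (rule uniformly_finite_step) (use boundary_cases in auto)
  with pos have "uniformly_finite T ({x. 0 < x \<bullet> e} \<union> {x. x \<bullet> e = 0})"
    by (rule uniformly_finite_Un)
  then show ?thesis
    by (rule uniformly_finite_subset) auto
qed

lemma uniformly_finite_forward_projection: "uniformly_finite T {x. 0 \<le> A.P x \<bullet> e}"
proof (rule uniformly_finite_step[OF uniformly_finite_forward])
  fix x assume "x \<in> {x. 0 \<le> A.P x \<bullet> e}"
  then show "T x \<in> {x. 0 \<le> x \<bullet> e}"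
    using T_forward[of x] by simp
qed

subsection \<open>Backward half-plane\<close>

text \<open>Here \<open>T x = p\<close>. The reflected point \<open>y\<close> lies in \<open>B\<close> and, below the edge \<open>p\<close>, also in \<open>A\<close>. It
forms an acute angle with \<open>p\<close>, so the projection of \<open>p\<close> onto \<open>B\<close> lies between \<open>y\<close> and \<open>p\<close>.\<close>

lemma backward_reflection_in_B:
  assumes p: "A.P x \<bullet> e < 0" "x - A.P x = t *\<^sub>R J (A.P x)" "t > 0"
    and y: "R x = B.P (R x)"
  shows "T (T x) \<in> Fix T"
proof -
  define p where "p = A.P x"
  have Tx: "T x = p"
    using y by (simp add: T_eq' p_def)
  have Rx: "R x = p - t *\<^sub>R J p"
    using p(2) by (simp add: R_eq p_def)
  have "p \<noteq> 0"
    using p(1) by (auto simp: p_def)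
  have JJ: "J p \<bullet> J p = p \<bullet> p" "p \<bullet> J p = 0"
    using inner_frame[OF frame, of p p] by (simp_all add: inner_J fr)
  have "0 \<le> R x \<bullet> f"
    using edge_up[OF p(2,3)] mult_pos_neg[OF p(3,1)] by (simp add: Rx inner_diff_left fr p_def)
  moreover have neg: "R x \<bullet> J p < 0"
    using JJ p(3) \<open>p \<noteq> 0\<close> by (simp add: Rx inner_diff_left)
  ultimately have RA: "R x \<in> A"
    using below_edge_mem[OF A.P_mem edge_polar[OF p(2,3)]] by (simp add: p_def)
  have "0 \<le> p \<bullet> R x"
    using JJ by (simp add: Rx inner_diff_right)
  moreover have "R x \<noteq> 0" "R x \<in> B"
    using neg B.P_mem[of "R x"] y by auto
  ultimately have "B.P p \<in> A"
    using B.P_between[of "R x" p] A.comb_mem[OF RA A.P_mem[of x]] by (metis p_def)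
  then show ?thesis
    using B.P_mem A.P_mem[of x] by (simp add: Tx T_on_A p_def Fix_Int)
qed

text \<open>Such a \<open>T x\<close> in the backward half-plane has negative products with \<open>p\<close> and with \<open>e\<close>. Vectors
of \<open>A\<close> in the backward half-plane are combinations of \<open>e\<close> and \<open>p\<close> with nonnegative
coefficients, so none of them can be the projection of \<open>T x\<close>. (If \<open>p\<close> is opposite to \<open>e\<close>, the
two signs already contradict each other.)\<close>

lemma backward_obtuse:
  assumes p: "A.P x \<bullet> e < 0" "x - A.P x = t *\<^sub>R J (A.P x)" "t > 0"
    and obtuse: "B.P (R x) \<bullet> A.P x < 0"
  shows "0 \<le> T x \<bullet> e \<or> 0 \<le> A.P (T x) \<bullet> e"
proof (rule ccontr)
  define p where "p = A.P x"
  define q where "q = T x"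
  define p' where "p' = A.P q"
  assume "\<not> ?thesis"
  then have qe: "q \<bullet> e < 0" and p'e: "p' \<bullet> e < 0"
    by (auto simp: q_def p'_def)
  have pe: "p \<bullet> e < 0" and pf: "0 \<le> p \<bullet> f"
    using p(1) edge_up[OF p(2,3)] by (auto simp: p_def)
  have "q \<bullet> p = B.P (R x) \<bullet> p"
    using A.P_orth[of x] by (simp add: q_def T_eq inner_add_left p_def)
  then have qp: "q \<bullet> p < 0"
    using obtuse by (simp add: p_def)
  have qp_exp: "q \<bullet> p = (q \<bullet> e) * (p \<bullet> e) + (q \<bullet> f) * (p \<bullet> f)"
    by (rule inner_frame[OF frame])
  have pf: "0 < p \<bullet> f"
    using pf qp qp_exp mult_neg_neg[OF qe pe] by (cases "p \<bullet> f = 0") auto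
  have edge: "(p' \<bullet> f) * (p \<bullet> e) \<le> (p' \<bullet> e) * (p \<bullet> f)"
    using edge_polar[OF p(2,3), of p'] A.P_mem by (simp add: inner_J p_def p'_def)
  also have "\<dots> < 0"
    using p'e pf by (rule mult_neg_pos)
  finally have p'f: "0 < p' \<bullet> f"
    using pe by (auto simp: mult_less_0_iff)
  have "q \<bullet> p' = p' \<bullet> p'"
    using A.P_orth[of q] by (simp add: p'_def inner_diff_left)
  then have "0 \<le> (p \<bullet> f) * (q \<bullet> p')"
    using pf by simp
  also have "(p \<bullet> f) * (q \<bullet> p')
      = (q \<bullet> e) * ((p' \<bullet> e) * (p \<bullet> f) - (p' \<bullet> f) * (p \<bullet> e)) + (p' \<bullet> f) * (q \<bullet> p)"
    unfolding qp_exp inner_frame[OF frame, of q p'] by (simp add: algebra_simps)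
  also have "\<dots> < 0"
    using qe edge p'f qp by (intro add_nonpos_neg mult_nonpos_nonneg mult_pos_neg) auto
  finally show False
    by simp
qed

text \<open>Backwards, the rotation moves \<open>x\<close> away from the edge \<open>p\<close>, but not beyond a right angle, so the
next point is projected on the same ray. The sign information \<open>b \<bullet> e < 0\<close>, \<open>b \<bullet> f \<le> 0\<close>
shows that \<open>b\<close> is not clockwise of \<open>p\<close>.\<close>

lemma backward_rotating:
  assumes p: "A.P x \<bullet> e < 0" "x - A.P x = t *\<^sub>R J (A.P x)" "t > 0"
    and b: "B.P (R x) \<noteq> 0" "R x - B.P (R x) = r *\<^sub>R J (B.P (R x))" "r < 0"
  shows "A.P (T x) \<bullet> e < 0" "\<exists>t'>0. T x - A.P (T x) = t' *\<^sub>R J (A.P (T x))"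
proof -
  define p where "p = A.P x"
  define b where "b = B.P (R x)"
  have pe: "p \<bullet> e < 0" and pf: "0 \<le> p \<bullet> f"
    using p(1) edge_up[OF p(2,3)] by (auto simp: p_def)
  have "p \<noteq> 0"
    using pe by auto
  have pp: "p \<bullet> p > 0"
    using \<open>p \<noteq> 0\<close> by simp
  have y: "R x = p - t *\<^sub>R J p" "R x = b + r *\<^sub>R J b"
    using p(2) b(2) by (simp_all add: R_eq p_def b_def algebra_simps)
  have bf: "b \<bullet> f \<le> 0"
    using B.P_polar[OF e_mem(2), of "R x"] b(2,3) by (simp add: b_def fr zero_le_mult_iff)
  have "0 < R x \<bullet> f"
    using pf mult_pos_neg[OF p(3) pe] by (simp add: y(1) inner_diff_left fr)
  then have "0 < b \<bullet> f + r * (b \<bullet> e)"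
    by (simp add: y(2) inner_add_left fr)
  then have be: "b \<bullet> e < 0"
    using bf b(3) by (smt (verit) mult_nonpos_nonneg)
  have bJp: "0 \<le> b \<bullet> J p"
    using mult_nonpos_nonpos[OF bf less_imp_le[OF pe]] mult_nonpos_nonneg[OF less_imp_le[OF be] pf]
    by (simp add: inner_J)
  have "b \<bullet> J b = 0"
    by (simp add: inner_J)
  then have "b \<bullet> b = b \<bullet> p - t * (b \<bullet> J p)"
    using arg_cong[OF trans[OF y(2)[symmetric] y(1)], of "\<lambda>z. b \<bullet> z"]
    by (simp add: inner_diff_right inner_add_right)
  moreover have "b \<bullet> b > 0"
    using b(1) by (simp add: b_def)
  ultimately have bp: "0 < b \<bullet> p"
    using mult_nonneg_nonneg[OF less_imp_le[OF p(3)] bJp] by simp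
  have Tx: "T x = t *\<^sub>R J p + b"
    using p(2) by (simp add: T_eq p_def b_def)
  have JJ: "J p \<bullet> J p = p \<bullet> p" "p \<bullet> J p = 0" "J p \<bullet> p = 0"
    using inner_frame[OF frame, of p p] by (simp_all add: inner_J fr inner_commute[of "J p" p])
  define k where "k = (b \<bullet> p) / (p \<bullet> p)"
  have k: "k > 0" "k * (p \<bullet> p) = b \<bullet> p"
    using bp pp by (auto simp: k_def)
  have orth: "(T x - k *\<^sub>R p) \<bullet> p = 0"
    using k(2) by (simp add: Tx inner_diff_left inner_add_left JJ)
  then obtain s where s: "T x - k *\<^sub>R p = s *\<^sub>R J p"
    using orthogonal_quarter_turn[OF frame \<open>p \<noteq> 0\<close>] by blast
  have "t * (p \<bullet> p) + b \<bullet> J p = s * (p \<bullet> p)"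
    using arg_cong[OF s, of "\<lambda>z. z \<bullet> J p"] by (simp add: Tx inner_diff_left inner_add_left JJ)
  then have "0 < s * (p \<bullet> p)"
    using bJp mult_pos_pos[OF p(3) pp] by simp
  then have s0: "s > 0"
    using pp by (simp add: zero_less_mult_iff)
  have P: "A.P (T x) = k *\<^sub>R p"
  proof (rule A.P_eqI)
    show "k *\<^sub>R p \<in> A"
      using k A.P_mem[of x] by (intro A.scale_mem) (auto simp: p_def)
    show "(T x - k *\<^sub>R p) \<bullet> k *\<^sub>R p = 0"
      using orth by simp
    show "(T x - k *\<^sub>R p) \<bullet> z \<le> 0" if "z \<in> A" for z
      unfolding s using edge_polar[OF p(2,3) that] s0
      by (simp add: p_def inner_commute mult_le_0_iff)
  qed
  show "A.P (T x) \<bullet> e < 0"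
    using k pe by (simp add: P mult_pos_neg)
  have "T x - A.P (T x) = (s / k) *\<^sub>R J (A.P (T x))"
    using k(1) by (simp add: P s quarter_turn_def algebra_simps)
  then show "\<exists>t'>0. T x - A.P (T x) = t' *\<^sub>R J (A.P (T x))"
    using k(1) s0 by (intro exI[of _ "s / k"]) auto
qed

lemma uniformly_finite_backward:
  "uniformly_finite T {x. A.P x \<bullet> e < 0 \<and> (\<exists>t>0. x - A.P x = t *\<^sub>R J (A.P x))}"
    (is "uniformly_finite T ?L")
proof -
  define W where "W = {x \<in> rotating. A.P x \<bullet> e < 0}"
  define S where "S = {x. T (T x) \<in> Fix T} \<union> {x. 0 \<le> A.P (T x) \<bullet> e}"
  have "uniformly_finite T {x. 0 \<le> A.P (T x) \<bullet> e}"
    by (rule uniformly_finite_step[OF uniformly_finite_forward_projection]) simp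
  then have S: "uniformly_finite T S"
    unfolding S_def by (intro uniformly_finite_Un[OF uniformly_finite_two_steps]) auto
  have sub: "x \<in> W \<union> S" if "x \<in> ?L" for x
  proof -
    obtain t where p: "A.P x \<bullet> e < 0" "x - A.P x = t *\<^sub>R J (A.P x)" "t > 0"
      using \<open>x \<in> ?L\<close> by blast
    have p0: "A.P x \<noteq> 0"
      using p(1) by auto
    show ?thesis
    proof (cases "B.P (R x) = 0")
      case True
      then have "T x = x - A.P x"
        by (simp add: T_eq)
      moreover have "A.P (x - A.P x) = 0"
        using A.P_polar by (intro A.P_eqI A.zero_mem) auto
      ultimately show ?thesis
        by (simp add: S_def)
    next
      case False
      then show ?thesis
      proof (cases rule: turn_cases)
        case 1
        then show ?thesis
          using backward_reflection_in_B[OF p] by (simp add: S_def)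
      next
        case (2 r)
        show ?thesis
        proof (cases "0 \<le> B.P (R x) \<bullet> A.P x")
          case True
          then show ?thesis
            using cw_two_steps[OF p0 p(2,3) False 2(2,1)] by (simp add: S_def)
        next
          case False
          then have "0 \<le> T x \<bullet> e \<or> 0 \<le> A.P (T x) \<bullet> e"
            by (intro backward_obtuse[OF p]) simp
          then show ?thesis
            using P_forward[of "T x"] by (auto simp: S_def)
        qed
      next
        case (3 r)
        then show ?thesis
          using p p0 False by (auto simp: W_def rotating_def)
      qed
    qed
  qed
  have img: "T x \<in> W \<union> S" if "x \<in> W" for x
  proof (rule sub)
    obtain t r where "A.P x \<bullet> e < 0" "x - A.P x = t *\<^sub>R J (A.P x)" "t > 0"
      "B.P (R x) \<noteq> 0" "R x - B.P (R x) = r *\<^sub>R J (B.P (R x))" "r < 0"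
      using \<open>x \<in> W\<close> unfolding W_def rotating_def by blast
    from backward_rotating[OF this] show "T x \<in> ?L"
      by blast
  qed
  have "uniformly_finite T W"
  proof (cases "W = {}")
    case True
    then show ?thesis
      by (simp add: uniformly_finite_def)
  next
    case False
    then obtain x0 where x0: "x0 \<in> rotating" "A.P x0 \<bullet> e < 0"
      by (auto simp: W_def)
    define a where "a = (1 / norm (A.P x0)) *\<^sub>R A.P x0"
    obtain b where ab: "a \<bullet> a = 1" "b \<bullet> b = 1"
      and Pa: "\<And>x. x \<in> rotating \<Longrightarrow> A.P x = (x \<bullet> a) *\<^sub>R a"
      and T: "\<And>x. x \<in> rotating \<Longrightarrow>
         T x = x - (x \<bullet> a) *\<^sub>R a + ((2 *\<^sub>R (x \<bullet> a) *\<^sub>R a - x) \<bullet> b) *\<^sub>R b"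
      using rotating_edges[OF x0(1)] unfolding a_def by metis
    have "A.P x0 \<noteq> 0"
      using x0(2) by auto
    then have ae: "a \<bullet> e < 0"
      using x0(2) by (simp add: a_def divide_neg_pos)
    \<comment> \<open>The phase takes place in the quadrant between the edge of \<open>A\<close> and its quarter turn.\<close>
    have fra: "frame a (J a)"
      using ab(1) inner_frame[OF frame, of a a] by (simp add: frame_def inner_J fr)
    have quad: "0 \<le> x \<bullet> a \<and> 0 \<le> x \<bullet> J a" if "x \<in> W" for x
    proof -
      have x: "x \<in> rotating" "A.P x \<bullet> e < 0"
        using that by (auto simp: W_def)
      obtain t where t: "t > 0" "x - A.P x = t *\<^sub>R J (A.P x)"
        using x(1) by (auto simp: rotating_def)
      have xa: "0 < x \<bullet> a"
        using x(2) ae unfolding Pa[OF x(1)] by (simp add: mult_less_0_iff)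
      have "x = (x \<bullet> a) *\<^sub>R a + (t * (x \<bullet> a)) *\<^sub>R J a"
        using t(2) unfolding Pa[OF x(1)] by (simp add: quarter_turn_def algebra_simps)
      then have "x \<bullet> J a = ((x \<bullet> a) *\<^sub>R a + (t * (x \<bullet> a)) *\<^sub>R J a) \<bullet> J a"
        by simp
      also have "\<dots> = t * (x \<bullet> a)"
        using fra by (simp add: frame_def inner_add_left)
      finally show ?thesis
        using xa t(1) by simp
    qed
    show ?thesis
      by (rule uniformly_finite_two_lines[OF fra zero_Fix ab quad T img S]) (auto simp: W_def)
  qed
  then have "uniformly_finite T (W \<union> S)"
    using S by (rule uniformly_finite_Un)
  then show ?thesis
    by (rule uniformly_finite_subset) (use sub in auto)
qed

text \<open>Points of \<open>A\<close> are treated last: there is no edge attached to them, but one step leads to the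
projection onto \<open>B\<close>, which is either a fixed point or lies outside \<open>A\<close>.\<close>

lemma uniformly_finite_all: "uniformly_finite T UNIV"
proof -
  define V where "V = {x. 0 \<le> A.P x \<bullet> e}
    \<union> ({x. A.P x \<bullet> e < 0 \<and> (\<exists>t>0. x - A.P x = t *\<^sub>R J (A.P x))}
    \<union> {x. A.P x \<bullet> e < 0 \<and> (\<exists>t>0. x - A.P x = t *\<^sub>R quarter_turn e (- f) (A.P x))})"
  have V: "uniformly_finite T V"
    unfolding V_def
    by (intro uniformly_finite_Un uniformly_finite_forward_projection
        uniformly_finite_backward cone_pair.uniformly_finite_backward[OF flip])
  have out: "x \<in> V" if "x \<notin> A" for x
  proof (cases "0 \<le> A.P x \<bullet> e")
    case True
    then show ?thesis by (simp add: V_def)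
  next
    case False
    then have "A.P x \<noteq> 0"
      by auto
    then obtain t where t: "x - A.P x = t *\<^sub>R J (A.P x)"
      using orthogonal_quarter_turn[OF frame _ A.P_orth] by blast
    have "t \<noteq> 0"
      using t A.P_mem[of x] that by auto
    then consider "t > 0" | "- t > 0"
      by linarith
    then show ?thesis
    proof cases
      case 1
      then show ?thesis
        using t False by (auto simp: V_def)
    next
      case 2
      have "x - A.P x = (- t) *\<^sub>R quarter_turn e (- f) (A.P x)"
        unfolding t by (simp add: quarter_turn_def algebra_simps)
      then show ?thesis
        using 2 False unfolding V_def by (smt (verit) UnCI mem_Collect_eq)
    qed
  qed
  have "uniformly_finite T (V \<union> Fix T)"
    by (intro uniformly_finite_Un V uniformly_finite_Fix order.refl)
  then have "uniformly_finite T A"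
  proof (rule uniformly_finite_step)
    fix x assume "x \<in> A"
    then show "T x \<in> V \<union> Fix T"
      using B.P_mem[of x] out[of "T x"] Fix_Int[of "T x"] by (auto simp: T_on_A)
  qed
  with V have "uniformly_finite T (V \<union> A)"
    by (rule uniformly_finite_Un)
  then show ?thesis
    by (rule uniformly_finite_subset) (use out in auto)
qed

end

section \<open>The case of a line\<close>

lemma (in closed_convex_cone) P_line:
  assumes "frame e f" "e \<in> C" "- e \<in> C" "\<forall>w\<in>C. w \<bullet> f = 0"
  shows "P x = (x \<bullet> e) *\<^sub>R e"
proof (rule P_eqI)
  show "(x \<bullet> e) *\<^sub>R e \<in> C"
    using scale_mem[OF assms(2), of "x \<bullet> e"] scale_mem[OF assms(3), of "- (x \<bullet> e)"]
    by (cases "x \<bullet> e \<ge> 0") auto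
  show "(x - (x \<bullet> e) *\<^sub>R e) \<bullet> (x \<bullet> e) *\<^sub>R e = 0"
    by (simp add: inner_diff_left frame_inner_simps[OF assms(1)])
  show "(x - (x \<bullet> e) *\<^sub>R e) \<bullet> z \<le> 0" if "z \<in> C" for z
    using assms(4) that
    by (subst inner_frame[OF assms(1)]) (simp add: inner_diff_left frame_inner_simps[OF assms(1)])
qed

lemma uniformly_finite_conjugate:
  assumes R: "\<And>x. R (R x) = x" and T: "\<And>x. T x = R (U (R x))"
    and U: "uniformly_finite U UNIV"
  shows "uniformly_finite T UNIV"
proof -
  obtain n where n: "\<And>x. (U ^^ n) x \<in> Fix U"
    using U unfolding uniformly_finite_def by blast
  have "(T ^^ k) x = R ((U ^^ k) (R x))" for k x
    by (induction k) (simp_all add: R T)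
  then have "(T ^^ n) x \<in> Fix T" for x
    using n[of "R x"] by (simp add: Fix_def R T)
  then show ?thesis
    unfolding uniformly_finite_def by blast
qed

theorem corollary2p4:
  fixes A B :: "(real ^ 2) set"
  assumes "closed A" "convex A" "pos_cone A"
    and "closed B" "convex B" "pos_cone B"
    and "\<exists>x y. x \<in> A \<inter> B \<and> y \<in> A \<inter> B \<and> x \<noteq> y"
  shows "\<exists>n::nat. \<forall>x0. (T_DR A B ^^ n) x0 \<in> Fix (T_DR A B)"
proof -
  obtain g where g: "g \<in> A" "g \<in> B" "g \<noteq> 0"
    using assms(7) by (metis IntD1 IntD2)
  interpret A: closed_convex_cone A
    using assms g by unfold_locales auto
  interpret B: closed_convex_cone B
    using assms g by unfold_locales auto
  define e where "e = (1 / norm g) *\<^sub>R g"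
  have e: "e \<in> A" "e \<in> B"
    using g by (auto simp: e_def intro: A.scale_mem B.scale_mem)
  have "e \<bullet> e = 1"
    using g(3) by (simp add: e_def dot_square_norm power2_eq_square)
  then obtain f where fr: "frame e f"
    using frame_exists by blast
  have "uniformly_finite (T_DR A B) UNIV"
  proof (cases "- e \<in> A \<and> (\<forall>w\<in>A. w \<bullet> f = 0)")
    case False
    then interpret cone_pair A B e f
      using fr e by unfold_locales auto
    show ?thesis
      by (rule uniformly_finite_all)
  next
    case True
    then have PA: "A.P x = (x \<bullet> e) *\<^sub>R e" for x
      using A.P_line[OF fr e(1)] by blast
    have RA: "reflector A x = (2 * (x \<bullet> e)) *\<^sub>R e - x" for x
      by (simp add: reflector_def PA)
    have RR: "reflector A (reflector A x) = x" for x
      by (simp add: RA inner_diff_left frame_inner_simps[OF fr] algebra_simps)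
    show ?thesis
    proof (cases "- e \<in> B \<and> (\<forall>w\<in>B. w \<bullet> f = 0)")
      case False
      then interpret BA: cone_pair B A e f
        using fr e by unfold_locales auto
      \<comment> \<open>\<open>reflector A\<close> is linear and involutive, so it maps
        \<open>z + R\<^sub>A (R\<^sub>B z)\<close> with \<open>z = R\<^sub>A x\<close> to \<open>x + R\<^sub>B (R\<^sub>A x)\<close>.\<close>
      have "T_DR A B x = reflector A (T_DR B A (reflector A x))" for x
        unfolding T_DR_def comp_apply RA[of "(1/2) *\<^sub>R _"]
        by (simp add: RA inner_add_left inner_diff_left frame_inner_simps[OF fr] algebra_simps)
      then show ?thesis
        using uniformly_finite_conjugate[OF RR] BA.uniformly_finite_all by blast
    next
      case True
      then have "B.P x = (x \<bullet> e) *\<^sub>R e" for x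
        using B.P_line[OF fr e(2)] by blast
      then have "reflector B = reflector A"
        by (simp add: reflector_def[abs_def] PA)
      then have "T_DR A B x = x" for x
        by (simp add: T_DR_def RR scaleR_2[symmetric])
      then show ?thesis
        by (intro uniformly_finite_Fix) (auto simp: Fix_def)
    qed
  qed
  then show ?thesis
    unfolding uniformly_finite_def by simp
qed

end
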